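(* Let $T\in\mathbb{B}(\mathcal{H})$ be a bounded linear operator on a complex Hilbert space $\mathcal{H}$ and let $\lambda\in[0,1]$. Then $$\|M_\lambda(T)\|\le \frac{\big\|\lambda|T|+(1-\lambda)|T^D|\big\|+\big\|\lambda|T^*|+(1-\lambda)|(T^D)^*|\big\|}{2}\le \lambda\|T\|+(1-\lambda)\|T^D\|.$$ In particular, $$\|\widehat{T}\|\le \frac{\big\||T|+|T^D|\big\|+\big\||T^*|+|(T^D)^*|\big\|}{4}\le\|T\|.$$
   Context: $\mathbb{B}(\mathcal{H})$ is the algebra of bounded linear operators on the complex Hilbert space $\mathcal{H}$, $\|\cdot\|$ the operator norm, and $|A|=(A^*A)^{1/2}$ for $A\in\mathbb{B}(\mathcal{H})$. $T=U|T|$ denotes the canonical polar decomposition, where $U$ is the unique partial isometry with $T=U|T|$ and $\mathcal{N}(U)=\mathcal{N}(T)$ (null spaces). The Duggal transform of $T$ is $T^D:=|T|U$. For $\lambda\in[0,1]$ the $\lambda$-mean transform of $T$ is $M_\lambda(T):=\lambda T+(1-\lambda)T^D$, and $\widehat{T}:=M_{1/2}(T)=\frac12(T+T^D)$ is the mean transform. *)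

theory Defs
  imports "HOL-Analysis.Analysis"
begin

class complex_vector = real_vector +
  fixes scaleC :: "complex \<Rightarrow> 'a \<Rightarrow> 'a"  (infixr "*\<^sub>C" 75)
  assumes scaleC_add_right: "c *\<^sub>C (x + y) = c *\<^sub>C x + c *\<^sub>C y"
    and scaleC_add_left: "(c + d) *\<^sub>C x = c *\<^sub>C x + d *\<^sub>C x"
    and scaleC_scaleC: "c *\<^sub>C d *\<^sub>C x = (c * d) *\<^sub>C x"
    and scaleC_of_real: "complex_of_real r *\<^sub>C x = r *\<^sub>R x"

text \<open>The inner product is linear in its first argument. The last axiom says both that it is
  positive definite and that the norm is the one it induces.\<close>

class complex_inner = complex_vector + real_normed_vector +
  fixes cinner :: "'a \<Rightarrow> 'a \<Rightarrow> complex"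
  assumes cinner_commute: "cinner y x = cnj (cinner x y)"
    and cinner_add_left: "cinner (x + y) z = cinner x z + cinner y z"
    and cinner_scaleC_left: "cinner (c *\<^sub>C x) y = c * cinner x y"
    and cinner_self: "cinner x x = complex_of_real ((norm x)\<^sup>2)"

class complex_hilbert_space = complex_inner + complete_space

instantiation complex :: complex_hilbert_space
begin

definition scaleC_complex :: "complex \<Rightarrow> complex \<Rightarrow> complex"
  where "scaleC_complex c x = c * x"

definition cinner_complex :: "complex \<Rightarrow> complex \<Rightarrow> complex"
  where "cinner_complex x y = x * cnj y"

instance
proof
  fix x :: complex
  show "cinner x x = complex_of_real ((norm x)\<^sup>2)"
    unfolding cinner_complex_def by (rule complex_norm_square [symmetric])
qed (auto simp: scaleC_complex_def cinner_complex_def algebra_simps scaleR_conv_of_real)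

end

text \<open>Operators are functions; the operator norm is \<^const>\<open>onorm\<close>.\<close>

definition bounded_clinear :: "('a::complex_inner \<Rightarrow> 'a) \<Rightarrow> bool"
  where "bounded_clinear A \<longleftrightarrow> bounded_linear A \<and> (\<forall>c x. A (c *\<^sub>C x) = c *\<^sub>C A x)"

definition cadjoint :: "('a::complex_hilbert_space \<Rightarrow> 'a) \<Rightarrow> 'a \<Rightarrow> 'a"
  where "cadjoint A =
    (THE B. bounded_clinear B \<and> (\<forall>x y. cinner (A x) y = cinner x (B y)))"

definition positive_op :: "('a::complex_hilbert_space \<Rightarrow> 'a) \<Rightarrow> bool"
  where "positive_op P \<longleftrightarrow> bounded_clinear P \<and> (\<forall>x. cinner (P x) x \<in> \<real>\<^sub>\<ge>\<^sub>0)"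

definition sqrt_op :: "('a::complex_hilbert_space \<Rightarrow> 'a) \<Rightarrow> 'a \<Rightarrow> 'a"
  where "sqrt_op A = (THE P. positive_op P \<and> P \<circ> P = A)"

definition abs_op :: "('a::complex_hilbert_space \<Rightarrow> 'a) \<Rightarrow> 'a \<Rightarrow> 'a"
  where "abs_op A = sqrt_op (cadjoint A \<circ> A)"

text \<open>A partial isometry is isometric on the orthogonal complement of its null space.\<close>

definition partial_isometry :: "('a::complex_hilbert_space \<Rightarrow> 'a) \<Rightarrow> bool"
  where "partial_isometry U \<longleftrightarrow> bounded_clinear U \<and>
    (\<forall>x. (\<forall>y. U y = 0 \<longrightarrow> cinner x y = 0) \<longrightarrow> norm (U x) = norm x)"

definition polar_part :: "('a::complex_hilbert_space \<Rightarrow> 'a) \<Rightarrow> 'a \<Rightarrow> 'a"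
  where "polar_part T =
    (THE U. partial_isometry U \<and> T = U \<circ> abs_op T \<and> {x. U x = 0} = {x. T x = 0})"

definition duggal :: "('a::complex_hilbert_space \<Rightarrow> 'a) \<Rightarrow> 'a \<Rightarrow> 'a"
  where "duggal T = abs_op T \<circ> polar_part T"

definition lambda_mean :: "real \<Rightarrow> ('a::complex_hilbert_space \<Rightarrow> 'a) \<Rightarrow> 'a \<Rightarrow> 'a"
  where "lambda_mean l T = (\<lambda>x. l *\<^sub>R T x + (1 - l) *\<^sub>R duggal T x)"

definition mean_transform :: "('a::complex_hilbert_space \<Rightarrow> 'a) \<Rightarrow> 'a \<Rightarrow> 'a"
  where "mean_transform T = lambda_mean (1/2) T"

end

theory Submission
  imports Defs
begin

text \<open>For every operator \<open>A\<close> with polar decomposition \<open>A = U|A|\<close> one has \<open>|A\<^sup>*| = U|A|U\<^sup>*\<close>,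
  so the Cauchy-Schwarz inequality for the positive form \<open>\<langle>|A| \<cdot>, \<cdot>\<rangle>\<close> gives the mixed inequality
  \<open>|\<langle>A x, y\<rangle>|\<^sup>2 \<le> \<langle>|A| x, x\<rangle> \<langle>|A\<^sup>*| y, y\<rangle>\<close>. Applying it with AM-GM to the two summands of a
  combination \<open>S = a A + b B\<close> bounds \<open>2 |\<langle>S x, y\<rangle>|\<close> by the quadratic forms of \<open>a|A| + b|B|\<close> at \<open>x\<close>
  and of \<open>a|A\<^sup>*| + b|B\<^sup>*|\<close> at \<open>y\<close>; taking \<open>y\<close> parallel to \<open>S x\<close> with \<open>\<parallel>y\<parallel> = \<parallel>x\<parallel>\<close> gives the first
  bound. The second is the triangle inequality with \<open>\<parallel>|A|\<parallel> = \<parallel>A\<parallel>\<close>, \<open>\<parallel>|A\<^sup>*|\<parallel> \<le> \<parallel>A\<parallel>\<close>.\<close>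

subsection \<open>Inner products and bounded operators\<close>

text \<open>This opens the way to absolutely convergent series in the space; the square root is
  later built from one.\<close>

instance complex_hilbert_space \<subseteq> banach ..

lemma cinner_add_right: "cinner x (y + z) = cinner x y + cinner x (z :: 'a::complex_inner)"
  by (metis cinner_add_left cinner_commute complex_cnj_add)

lemma cinner_scaleC_right: "cinner x (c *\<^sub>C y) = cnj c * cinner x (y :: 'a::complex_inner)"
  by (metis cinner_commute cinner_scaleC_left complex_cnj_mult)

lemma cinner_scaleR_left: "cinner (r *\<^sub>R x) y = of_real r * cinner x (y :: 'a::complex_inner)"
  by (metis cinner_scaleC_left scaleC_of_real)

lemma cinner_scaleR_right: "cinner x (r *\<^sub>R y) = of_real r * cinner x (y :: 'a::complex_inner)"
  by (metis cinner_scaleC_right scaleC_of_real complex_cnj_complex_of_real)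

lemma cinner_minus_left: "cinner (- x) y = - cinner x (y :: 'a::complex_inner)"
  using cinner_scaleR_left[of "-1" x y] by simp

lemma cinner_minus_right: "cinner x (- y) = - cinner x (y :: 'a::complex_inner)"
  using cinner_scaleR_right[of x "-1" y] by simp

lemma cinner_diff_left: "cinner (x - y) z = cinner x z - cinner y (z :: 'a::complex_inner)"
  using cinner_add_left[of x "- y" z] by (simp add: cinner_minus_left)

lemma cinner_diff_right: "cinner x (y - z) = cinner x y - cinner x (z :: 'a::complex_inner)"
  using cinner_add_right[of x y "- z"] by (simp add: cinner_minus_right)

lemma cinner_zero_left [simp]: "cinner 0 (x :: 'a::complex_inner) = 0"
  using cinner_diff_left[of 0 0 x] by simp

lemma cinner_zero_right [simp]: "cinner (x :: 'a::complex_inner) 0 = 0"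
  using cinner_diff_right[of x 0 0] by simp

lemmas cinner_simps = cinner_add_left cinner_add_right cinner_diff_left cinner_diff_right
  cinner_minus_left cinner_minus_right
  cinner_scaleC_left cinner_scaleC_right cinner_scaleR_left cinner_scaleR_right

lemma cinner_self_eq_0: "cinner x x = 0 \<longleftrightarrow> x = (0 :: 'a::complex_inner)"
  by (simp add: cinner_self)

lemma cinner_eqI:
  fixes x :: "'a::complex_inner"
  assumes "\<And>z. cinner x z = cinner y z"
  shows "x = y"
proof -
  have "cinner (x - y) (x - y) = 0"
    by (subst cinner_diff_left) (simp add: assms)
  then show ?thesis by (simp add: cinner_self_eq_0)
qed

lemma cinner_eqI_right:
  fixes x :: "'a::complex_inner"
  assumes "\<And>z. cinner z x = cinner z y"
  shows "x = y"
  by (rule cinner_eqI) (metis assms cinner_commute)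

lemma scaleC_scaleR: "c *\<^sub>C r *\<^sub>R x = r *\<^sub>R c *\<^sub>C (x :: 'a::complex_vector)"
  by (metis scaleC_of_real scaleC_scaleC mult.commute)

lemma scaleC_diff_right: "c *\<^sub>C (x - y) = c *\<^sub>C x - c *\<^sub>C (y :: 'a::complex_vector)"
  by (metis add_diff_cancel diff_add_cancel scaleC_add_right)

section \<open>Calculus of bounded complex-linear operators\<close>

context
  fixes A :: "'a::complex_inner \<Rightarrow> 'a"
  assumes A: "bounded_clinear A"
begin

lemma bounded_clinear_bounded_linear: "bounded_linear A"
  using A by (simp add: bounded_clinear_def)

lemma bounded_clinear_scaleC: "A (c *\<^sub>C x) = c *\<^sub>C A x"
  using A by (simp add: bounded_clinear_def)

lemma bounded_clinear_add: "A (x + y) = A x + A y"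
  using linear_simps(1)[OF bounded_clinear_bounded_linear] .

lemma bounded_clinear_diff: "A (x - y) = A x - A y"
  using linear_simps(2)[OF bounded_clinear_bounded_linear] .

lemma bounded_clinear_scaleR: "A (r *\<^sub>R x) = r *\<^sub>R A x"
  using linear_simps(5)[OF bounded_clinear_bounded_linear] .

lemma bounded_clinear_zero: "A 0 = 0"
  using linear_simps(3)[OF bounded_clinear_bounded_linear] .

lemma bounded_clinear_norm_le: "norm (A x) \<le> onorm A * norm x"
  by (rule onorm[OF bounded_clinear_bounded_linear])

end

lemmas bounded_clinear_simps = bounded_clinear_scaleC bounded_clinear_add bounded_clinear_diff
  bounded_clinear_scaleR bounded_clinear_zero

lemma bounded_clinearI:
  assumes "\<And>x y. A (x + y) = A x + A y" "\<And>c x. A (c *\<^sub>C x) = c *\<^sub>C A x"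
    and "\<And>x. norm (A x) \<le> norm x * K"
  shows "bounded_clinear A"
  unfolding bounded_clinear_def
proof (intro conjI allI)
  show "bounded_linear A"
    by (rule bounded_linear_intro[of _ K]) (use assms in \<open>auto simp flip: scaleC_of_real\<close>)
qed (use assms in auto)

lemma bounded_clinear_id: "bounded_clinear (\<lambda>x. x)"
  by (rule bounded_clinearI[of _ 1]) auto

lemma bounded_clinear_compose:
  assumes "bounded_clinear A" "bounded_clinear B"
  shows "bounded_clinear (A \<circ> B)"
  using assms bounded_linear_compose[of A B] by (simp add: bounded_clinear_def comp_def)

text \<open>The norm is tied to complex scalars only through \<open>cinner_self\<close>, so the
  squares are compared.\<close>

lemma norm_scaleC: "norm (c *\<^sub>C x) = cmod c * norm (x :: 'a::complex_inner)"
proof -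
  have "complex_of_real ((norm (c *\<^sub>C x))\<^sup>2) = of_real ((cmod c * norm x)\<^sup>2)"
    using complex_norm_square[of c]
    unfolding cinner_self[symmetric] cinner_scaleC_left cinner_scaleC_right
    by (simp add: cinner_self power_mult_distrib mult.assoc)
  then have "(norm (c *\<^sub>C x))\<^sup>2 = (cmod c * norm x)\<^sup>2"
    by (simp only: of_real_eq_iff)
  then show ?thesis by simp
qed

lemma bounded_linear_scaleC: "bounded_linear (\<lambda>x :: 'a::complex_inner. c *\<^sub>C x)"
  by (rule bounded_linear_intro[of _ "cmod c"])
    (auto simp: scaleC_add_right scaleC_scaleR norm_scaleC mult.commute)

lemma bounded_clinear_scaleR_fun:
  assumes "bounded_clinear A"
  shows "bounded_clinear (\<lambda>x. r *\<^sub>R A x)"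
  using assms by (simp add: bounded_clinear_def scaleC_scaleR bounded_linear_const_scaleR)

lemma bounded_clinear_add_fun:
  assumes "bounded_clinear A" "bounded_clinear B"
  shows "bounded_clinear (\<lambda>x. A x + B x)"
  using assms by (simp add: bounded_clinear_def bounded_linear_add scaleC_add_right)

lemma bounded_clinear_diff_fun:
  assumes "bounded_clinear A" "bounded_clinear B"
  shows "bounded_clinear (\<lambda>x. A x - B x)"
  using assms by (simp add: bounded_clinear_def bounded_linear_sub scaleC_diff_right)


subsection \<open>Positive operators\<close>

lemma positive_op_bounded_clinear: "positive_op P \<Longrightarrow> bounded_clinear P"
  by (simp add: positive_op_def)

lemma positive_opI:
  assumes "bounded_clinear P" "\<And>x. \<exists>r\<ge>0. cinner (P x) x = of_real r"
  shows "positive_op P"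
  unfolding positive_op_def using assms by (metis nonneg_Reals_of_real_iff)

lemma positive_op_cinner:
  assumes "positive_op P"
  shows "cinner (P x) x = of_real (Re (cinner (P x) x))" "Re (cinner (P x) x) \<ge> 0"
  using assms by (auto simp: positive_op_def complex_nonneg_Reals_iff complex_eq_iff)

text \<open>Polarization: positivity makes the quadratic form real. Reality at \<open>x + y\<close>
  compares imaginary parts, reality at \<open>x + \<i> *\<^sub>C y\<close> real parts.\<close>

lemma positive_op_selfadjoint:
  assumes P: "positive_op P"
  shows "cinner (P x) y = cinner x (P y)"
proof -
  note L = positive_op_bounded_clinear[OF P]
  have im0: "Im (cinner (P z) z) = 0" for z
    using positive_op_cinner(1)[OF P, of z] by (simp add: complex_eq_iff)
  have "Im (cinner (P x) y) = - Im (cinner (P y) x)"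
    using im0[of "x + y"] im0[of x] im0[of y]
    by (simp add: bounded_clinear_simps[OF L] cinner_simps)
  moreover have "Re (cinner (P x) y) = Re (cinner (P y) x)"
    using im0[of "x + \<i> *\<^sub>C y"] im0[of x] im0[of y]
    by (simp add: bounded_clinear_simps[OF L] cinner_simps)
  ultimately have "cinner (P x) y = cnj (cinner (P y) x)"
    by (simp add: complex_eq_iff)
  then show ?thesis by (metis cinner_commute)
qed

lemma positive_op_Cauchy_Schwarz:
  assumes P: "positive_op P"
  shows "(cmod (cinner (P x) y))\<^sup>2 \<le> Re (cinner (P x) x) * Re (cinner (P y) y)"
proof -
  note L = positive_op_bounded_clinear[OF P]
  define s p q where "s = cinner (P x) y" and "p = Re (cinner (P x) x)"
    and "q = Re (cinner (P y) y)"
  have p: "p \<ge> 0" and q: "q \<ge> 0" using positive_op_cinner(2)[OF P] by (auto simp: p_def q_def)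
  have s': "cinner (P y) x = cnj s"
    unfolding s_def by (metis P cinner_commute positive_op_selfadjoint)
  \<comment> \<open>Expand the form at \<open>x - (t * s) *\<^sub>C y\<close> for real
    \<open>t\<close>; the factor \<open>s\<close> makes the cross terms real multiples of
    |s|^2.\<close>
  have main: "p - 2 * t * (cmod s)\<^sup>2 + t\<^sup>2 * (cmod s)\<^sup>2 * q \<ge> 0" for t
  proof -
    have "Im (cinner (P y) y) = 0"
      using positive_op_cinner(1)[OF P, of y] by (simp add: complex_eq_iff)
    then have "Re (cinner (P (x - (t * s) *\<^sub>C y)) (x - (t * s) *\<^sub>C y))
       = p - 2 * t * (cmod s)\<^sup>2 + t\<^sup>2 * (cmod s)\<^sup>2 * q"
      by (simp add: bounded_clinear_simps[OF L] cinner_simps s' cmod_power2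
          flip: s_def) (simp add: p_def q_def algebra_simps power2_eq_square)
    then show ?thesis using positive_op_cinner(2)[OF P] by metis
  qed
  have "(cmod s)\<^sup>2 \<le> p * q"
  proof (cases "q = 0")
    \<comment> \<open>The bound is now affine in \<open>t\<close>: the value of \<open>t\<close>
      chosen below would give - p - 2 < 0.\<close>
    case True
    have "(cmod s)\<^sup>2 = 0"
    proof (rule ccontr)
      assume "(cmod s)\<^sup>2 \<noteq> 0"
      then show False
        using main[of "(p + 1) / (cmod s)\<^sup>2"] p True by simp
    qed
    then show ?thesis using p q by simp
  next
    case False
    \<comment> \<open>\<open>t = 1/q\<close> is the minimizer of the quadratic in
      \<open>main\<close>.\<close>
    then show ?thesis using main[of "1/q"] p q by (simp add: field_simps power2_eq_square)
  qed
  then show ?thesis by (simp add: s_def p_def q_def)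
qed

lemma positive_op_eq_0:
  assumes P: "positive_op P" and "cinner (P x) x = 0"
  shows "P x = 0"
  using positive_op_Cauchy_Schwarz[OF P, of x "P x"] assms by (simp add: cinner_self)

lemma positive_op_id: "positive_op (\<lambda>x. x)"
  by (rule positive_opI) (auto simp: bounded_clinear_id cinner_self simp flip: of_real_power)

lemma norm_cinner_le:
  fixes x :: "'a::complex_hilbert_space"
  shows "cmod (cinner x y) \<le> norm x * norm y"
  using positive_op_Cauchy_Schwarz[OF positive_op_id, of x y]
  by (simp add: cinner_self flip: power_mult_distrib)

lemma bounded_bilinear_cinner:
  "bounded_bilinear (cinner :: 'a::complex_hilbert_space \<Rightarrow> 'a \<Rightarrow> complex)"
  by standard (auto simp: cinner_simps scaleR_conv_of_real intro!: exI[of _ 1] norm_cinner_le)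

lemmas tendsto_cinner [tendsto_intros] = bounded_bilinear.tendsto[OF bounded_bilinear_cinner]

text \<open>Cauchy-Schwarz for the form of \<open>P\<close> at \<open>x\<close> and
  \<open>P x\<close>, then cancel \<open>(norm (P x))\<^sup>2\<close>. This turns a bound on the
  form into the contraction property that the square root series requires.\<close>

lemma positive_op_norm_le:
  assumes P: "positive_op P" and le: "\<And>x. Re (cinner (P x) x) \<le> (norm x)\<^sup>2"
  shows "norm (P x) \<le> norm x"
proof -
  have "((norm (P x))\<^sup>2)\<^sup>2 = (cmod (cinner (P x) (P x)))\<^sup>2"
    by (simp add: cinner_self norm_power)
  also have "\<dots> \<le> Re (cinner (P x) x) * Re (cinner (P (P x)) (P x))"
    by (rule positive_op_Cauchy_Schwarz[OF P])
  also have "\<dots> \<le> (norm x)\<^sup>2 * (norm (P x))\<^sup>2"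
    by (intro mult_mono le) (auto simp: positive_op_cinner(2)[OF P])
  finally have "(norm (P x))\<^sup>2 * (norm (P x))\<^sup>2 \<le> (norm x)\<^sup>2 * (norm (P x))\<^sup>2"
    by (simp add: power2_eq_square)
  then have "(norm (P x))\<^sup>2 \<le> (norm x)\<^sup>2" if "P x \<noteq> 0"
    using that by (subst (asm) mult_le_cancel_right) auto
  then show ?thesis by (cases "P x = 0") auto
qed

subsection \<open>Riesz representation, adjoints and projections\<close>

lemma norm_power2_eq_cinner: "(norm x)\<^sup>2 = Re (cinner x (x :: 'a::complex_inner))"
  by (simp add: cinner_self)

lemma Re_cinner_commute: "Re (cinner y x) = Re (cinner x (y :: 'a::complex_inner))"
  by (metis cinner_commute cnj.sel(1))

text \<open>With \<open>A\<close> the identity this is the Riesz representation theorem; other choices of \<open>A\<close> give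
  the orthogonal projection onto the closure of a range and the polar part. The vector is the limit
  of \<open>A x\<^sub>n\<close> for a minimizing sequence of \<open>\<parallel>A x\<parallel>\<^sup>2 - 2 Re (g x)\<close>.\<close>

lemma functional_representation:
  fixes A :: "'a::complex_hilbert_space \<Rightarrow> 'a" and g :: "'a \<Rightarrow> complex"
  assumes A: "bounded_clinear A"
    and g_add: "\<And>x y. g (x + y) = g x + g y"
    and g_scaleC: "\<And>c x. g (c *\<^sub>C x) = c * g x"
    and g_le: "\<And>x. cmod (g x) \<le> K * norm (A x)" and K: "0 \<le> K"
  obtains z where "z \<in> closure (range A)" "norm z \<le> K" "\<And>x. g x = cinner (A x) z"
proof -
  define J where "J x = (norm (A x))\<^sup>2 - 2 * Re (g x)" for x
  define m where "m = Inf (range J)"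
  have g_scaleR: "g (r *\<^sub>R x) = of_real r * g x" for r x
    using g_scaleC[of "of_real r" x] by (simp add: scaleC_of_real)
  have "J x \<ge> - (K\<^sup>2)" for x
  proof -
    have "Re (g x) \<le> K * norm (A x)"
      using g_le[of x] complex_Re_le_cmod[of "g x"] by linarith
    \<comment> \<open>Completing the square: \<open>J x\<close> is at least (norm (A x) - K)^2 -
      K^2.\<close>
    moreover have "(norm (A x) - K)\<^sup>2 \<ge> 0" by simp
    ultimately show ?thesis unfolding J_def power2_diff by (simp add: mult_ac)
  qed
  then have "bdd_below (range J)" by (intro bdd_belowI[of _ "- (K\<^sup>2)"]) auto
  then have m_le: "m \<le> J x" for x by (auto simp: m_def intro: cInf_lower)
  have "\<exists>x. J x < m + 1 / real (Suc n)" for n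
    using cInf_lessD[of "range J" "m + 1 / real (Suc n)"] by (auto simp: m_def)
  then obtain X where X: "\<And>n. J (X n) < m + 1 / real (Suc n)" by metis
  have J_add: "J (x + h) = J x + (norm (A h))\<^sup>2 + 2 * (Re (cinner (A h) (A x)) - Re (g h))" for x h
    using Re_cinner_commute[of "A x" "A h"]
    by (simp add: J_def norm_power2_eq_cinner bounded_clinear_simps[OF A] cinner_simps g_add)
  \<comment> \<open>The linear part of \<open>J\<close> cancels at the midpoint, leaving the
    parallelogram law. As the midpoint value is at least \<open>m\<close>, the images of a
    minimizing sequence are Cauchy.\<close>
  have parallelogram: "J x + J y - 2 * J ((1/2) *\<^sub>R (x + y)) = (norm (A x - A y))\<^sup>2 / 2" for x y
    using Re_cinner_commute[of "A x" "A y"]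
    by (simp add: J_def norm_power2_eq_cinner bounded_clinear_simps[OF A] cinner_simps g_add
        g_scaleR field_simps)
  have dist_X: "(norm (A (X i) - A (X j)))\<^sup>2 \<le> 2 / real (Suc i) + 2 / real (Suc j)" for i j
    using parallelogram[of "X i" "X j"] m_le[of "(1/2) *\<^sub>R (X i + X j)"] X[of i] X[of j] by argo
  have "Cauchy (\<lambda>n. A (X n))"
  proof (rule CauchyI)
    fix e :: real assume "e > 0"
    then obtain N where N: "4 / e\<^sup>2 < real N" using reals_Archimedean2 by blast
    have "norm (A (X i) - A (X j)) < e" if "i \<ge> N" "j \<ge> N" for i j
    proof -
      have "N > 0" using N \<open>e > 0\<close> by (cases N) auto
      then have "2 / real (Suc i) \<le> 2 / real N" "2 / real (Suc j) \<le> 2 / real N"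
        using that by (auto simp: frac_le)
      then have "(norm (A (X i) - A (X j)))\<^sup>2 \<le> 4 / real N"
        using dist_X[of i j] by simp
      also have "\<dots> < e\<^sup>2" using N \<open>N > 0\<close> \<open>e > 0\<close> by (simp add: field_simps)
      finally show ?thesis using \<open>e > 0\<close> by (simp add: power_less_imp_less_base)
    qed
    then show "\<exists>M. \<forall>i\<ge>M. \<forall>j\<ge>M. norm (A (X i) - A (X j)) < e" by blast
  qed
  then obtain z where z: "(\<lambda>n. A (X n)) \<longlonglongrightarrow> z" using Cauchy_convergent convergent_def by blast
  have Re_eq: "Re (g h) = Re (cinner (A h) z)" for h
  proof -
    define d a where "d = Re (cinner (A h) z) - Re (g h)" and "a = (norm (A h))\<^sup>2"
    \<comment> \<open>First variation: compare \<open>J (X n + t *\<^sub>R h)\<close> with the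
      near-minimal \<open>J (X n)\<close> and let \<open>n\<close> tend to infinity. Nonnegativity
      for every real \<open>t\<close> then forces \<open>d = 0\<close>.\<close>
    have quad: "t\<^sup>2 * a + 2 * t * d \<ge> 0" for t
    proof -
      have "t\<^sup>2 * a + 2 * t * (Re (cinner (A h) (A (X n))) - Re (g h)) + 1 / real (Suc n) \<ge> 0" for n
        using m_le[of "X n + t *\<^sub>R h"] X[of n]
        by (simp add: J_add a_def bounded_clinear_simps[OF A] cinner_simps g_scaleR
            power_mult_distrib algebra_simps)
      moreover have "(\<lambda>n. t\<^sup>2 * a + 2 * t * (Re (cinner (A h) (A (X n))) - Re (g h)) + 1 / real (Suc n))
        \<longlonglongrightarrow> t\<^sup>2 * a + 2 * t * (Re (cinner (A h) z) - Re (g h)) + 0"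
        by (intro tendsto_intros z LIMSEQ_Suc[OF lim_1_over_n])
      ultimately show ?thesis
        unfolding d_def by (metis (mono_tags, lifting) LIMSEQ_le_const add.right_neutral)
    qed
    have "a \<ge> 0" by (simp add: a_def)
    have "d = 0"
    proof (rule ccontr)
      assume "d \<noteq> 0"
      \<comment> \<open>The denominator \<open>a + 1\<close> instead of \<open>a\<close> covers the
        case \<open>A h = 0\<close>.\<close>
      have "(- d / (a + 1))\<^sup>2 * a + 2 * (- d / (a + 1)) * d = - (d\<^sup>2 * (a + 2)) / (a + 1)\<^sup>2"
        using \<open>a \<ge> 0\<close> by (simp add: divide_simps power2_eq_square) (simp add: algebra_simps)
      also have "\<dots> < 0"
        using \<open>a \<ge> 0\<close> \<open>d \<noteq> 0\<close> by (intro divide_neg_pos) auto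
      finally show False using quad[of "- d / (a + 1)"] by simp
    qed
    then show ?thesis by (simp add: d_def)
  qed
  \<comment> \<open>The real-part identity at \<open>\<i> *\<^sub>C x\<close> supplies the imaginary
    part.\<close>
  have g_eq: "g x = cinner (A x) z" for x
    using Re_eq[of x] Re_eq[of "\<i> *\<^sub>C x"]
    by (simp add: g_scaleC bounded_clinear_simps[OF A] cinner_simps complex_eq_iff)
  \<comment> \<open>Test the bound on \<open>g\<close> along the minimizing sequence, where
    \<open>g (X n)\<close> is the inner product of \<open>A (X n)\<close> with \<open>z\<close>, and
    pass to the limit.\<close>
  have "(norm z)\<^sup>2 \<le> K * norm z"
  proof (rule LIMSEQ_le)
    show "(\<lambda>n. cmod (cinner (A (X n)) z)) \<longlonglongrightarrow> (norm z)\<^sup>2"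
      using tendsto_norm[OF tendsto_cinner[OF z tendsto_const[of z]]]
      by (simp add: cinner_self norm_power)
    show "(\<lambda>n. K * norm (A (X n))) \<longlonglongrightarrow> K * norm z"
      by (intro tendsto_intros z)
    show "\<exists>N. \<forall>n\<ge>N. cmod (cinner (A (X n)) z) \<le> K * norm (A (X n))"
      using g_le g_eq by simp
  qed
  then have "norm z \<le> K" using K by (cases "z = 0") (auto simp: power2_eq_square)
  moreover have "z \<in> closure (range A)"
    unfolding closure_sequential by (rule exI[of _ "\<lambda>n. A (X n)"]) (simp add: z)
  ultimately show ?thesis using that[of z] g_eq by simp
qed

section \<open>Adjoints\<close>

lemma cadjoint_exists:
  fixes A :: "'a::complex_hilbert_space \<Rightarrow> 'a"
  assumes A: "bounded_clinear A"
  shows "\<exists>B. bounded_clinear B \<and> (\<forall>x y. cinner (A x) y = cinner x (B y))"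
proof -
  have "\<exists>z. norm z \<le> onorm A * norm y \<and> (\<forall>x. cinner (A x) y = cinner x z)" for y
  \<comment> \<open>Riesz representation of the functional sending \<open>x\<close> to
    \<open>cinner (A x) y\<close>. The norm bound on the representing vector later makes
    \<open>B\<close> bounded.\<close>
  proof (rule functional_representation[OF bounded_clinear_id, of "\<lambda>x. cinner (A x) y" "onorm A * norm y"])
    show "cmod (cinner (A x) y) \<le> onorm A * norm y * norm x" for x
      using norm_cinner_le[of "A x" y]
        mult_right_mono[OF bounded_clinear_norm_le[OF A, of x], of "norm y"]
      by (simp add: mult_ac)
    show "0 \<le> onorm A * norm y"
      by (simp add: onorm_pos_le[OF bounded_clinear_bounded_linear[OF A]])
  qed (auto simp: bounded_clinear_simps[OF A] cinner_simps)
  then obtain B where B: "\<And>x y. cinner (A x) y = cinner x (B y)"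
    and le: "\<And>y. norm (B y) \<le> onorm A * norm y" by metis
  have "bounded_clinear B"
  proof (rule bounded_clinearI[of _ "onorm A"])
    show "B (x + y) = B x + B y" for x y
      by (rule cinner_eqI_right) (simp add: cinner_simps flip: B)
    show "B (c *\<^sub>C x) = c *\<^sub>C B x" for c x
      by (rule cinner_eqI_right) (simp add: cinner_simps flip: B)
  qed (use le in \<open>simp add: mult.commute\<close>)
  with B show ?thesis by blast
qed

lemma cadjoint_eqI:
  fixes A :: "'a::complex_hilbert_space \<Rightarrow> 'a"
  assumes "bounded_clinear B" "\<And>x y. cinner (A x) y = cinner x (B y)"
  shows "cadjoint A = B"
  unfolding cadjoint_def
proof (rule the_equality)
  fix C assume C: "bounded_clinear C \<and> (\<forall>x y. cinner (A x) y = cinner x (C y))"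
  show "C = B" by (rule ext, rule cinner_eqI_right) (metis C assms(2))
qed (use assms in auto)

context
  fixes A :: "'a::complex_hilbert_space \<Rightarrow> 'a"
  assumes A: "bounded_clinear A"
begin

lemma bounded_clinear_cadjoint: "bounded_clinear (cadjoint A)"
  and cinner_cadjoint: "cinner (A x) y = cinner x (cadjoint A y)"
proof -
  obtain B where B: "bounded_clinear B" "\<And>x y. cinner (A x) y = cinner x (B y)"
    using cadjoint_exists[OF A] by blast
  then have "cadjoint A = B" by (rule cadjoint_eqI)
  then show "bounded_clinear (cadjoint A)" "cinner (A x) y = cinner x (cadjoint A y)"
    using B by simp_all
qed

lemma cinner_cadjoint_left: "cinner (cadjoint A x) y = cinner x (A y)"
  by (metis cinner_cadjoint cinner_commute)

lemma cadjoint_cadjoint: "cadjoint (cadjoint A) = A"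
  by (rule cadjoint_eqI) (auto simp: A cinner_cadjoint_left)

lemma positive_op_cadjoint_compose: "positive_op (cadjoint A \<circ> A)"
  by (rule positive_opI)
    (auto simp: cinner_cadjoint_left cinner_self bounded_clinear_compose A bounded_clinear_cadjoint
      simp flip: of_real_power)

text \<open>The square of \<open>norm (cadjoint A y)\<close> is the inner product of
  \<open>A (cadjoint A y)\<close> with \<open>y\<close>; bound it by Cauchy-Schwarz and cancel one
  factor \<open>norm (cadjoint A y)\<close>.\<close>

lemma onorm_cadjoint_le: "onorm (cadjoint A) \<le> onorm A"
proof (rule onorm_bound)
  show "0 \<le> onorm A" by (rule onorm_pos_le[OF bounded_clinear_bounded_linear[OF A]])
  fix y
  have "(norm (cadjoint A y))\<^sup>2 = Re (cinner (A (cadjoint A y)) y)"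
    by (simp add: cinner_cadjoint cinner_self)
  also have "\<dots> \<le> norm (A (cadjoint A y)) * norm y"
    using complex_Re_le_cmod norm_cinner_le order_trans by blast
  also have "\<dots> \<le> onorm A * norm (cadjoint A y) * norm y"
    by (intro mult_right_mono bounded_clinear_norm_le[OF A]) auto
  finally have "norm (cadjoint A y) * norm (cadjoint A y) \<le> (onorm A * norm y) * norm (cadjoint A y)"
    by (simp add: power2_eq_square mult_ac)
  then show "norm (cadjoint A y) \<le> onorm A * norm y"
    using \<open>0 \<le> onorm A\<close> by (cases "cadjoint A y = 0") (auto simp: mult_le_cancel_right)
qed

text \<open>The functional \<open>cinner (A x) y\<close>, bounded by a multiple of
  \<open>norm (A x)\<close>, is represented by a vector of the closed range: the orthogonal
  projection of \<open>y\<close>.\<close>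

lemma projection_closure_range:
  obtains p where "p \<in> closure (range A)" "\<And>x. cinner (A x) (y - p) = 0"
proof (rule functional_representation[OF A, of "\<lambda>x. cinner (A x) y" "norm y"])
  show "cmod (cinner (A x) y) \<le> norm y * norm (A x)" for x
    using norm_cinner_le[of "A x" y] by (simp add: mult.commute)
  fix z assume "z \<in> closure (range A)" "\<And>x. cinner (A x) y = cinner (A x) z"
  then show thesis using that[of z] by (simp add: cinner_simps)
qed (auto simp: bounded_clinear_simps[OF A] cinner_simps)

end

subsection \<open>Square roots of positive operators\<close>

text \<open>The coefficients of the binomial series of \<open>sqrt (1 - x)\<close>.\<close>

definition sqrt_coeff :: "nat \<Rightarrow> real"
  where "sqrt_coeff n = (-1) ^ n * ((1/2) gchoose n)"

lemma sqrt_coeff_0 [simp]: "sqrt_coeff 0 = 1"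
  by (simp add: sqrt_coeff_def)

lemma sqrt_coeff_Suc: "sqrt_coeff (Suc n) = sqrt_coeff n * (real n - 1/2) / real (Suc n)"
proof -
  have "(1/2 gchoose Suc n) = (1/2 gchoose n) * (1/2 - real n) / real (Suc n)"
    by (simp add: gbinomial_prod_rev)
  then show ?thesis unfolding sqrt_coeff_def by (simp only:) (simp add: field_simps)
qed

text \<open>The coefficient of index 1 is -1/2, and from there on the ratio in
  \<open>sqrt_coeff_Suc\<close> is positive.\<close>

lemma sqrt_coeff_nonpos: "sqrt_coeff (Suc n) \<le> 0"
proof (induction n)
  case (Suc n)
  then show ?case
    by (subst sqrt_coeff_Suc) (intro divide_nonpos_nonneg mult_nonpos_nonneg, auto)
qed (simp add: sqrt_coeff_Suc)

text \<open>The partial sums have a closed form, a negative multiple of the next coefficient, which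
  is itself nonpositive.\<close>

lemma sqrt_coeff_sum_nonneg: "(\<Sum>n\<le>m. sqrt_coeff n) \<ge> 0"
proof -
  have "(\<Sum>n\<le>m. sqrt_coeff n) = - 2 * real (Suc m) * sqrt_coeff (Suc m)"
  proof (induction m)
    case (Suc m)
    have "2 * real (Suc (Suc m)) * sqrt_coeff (Suc (Suc m)) = (2 * real m + 1) * sqrt_coeff (Suc m)"
      by (simp add: sqrt_coeff_Suc[of "Suc m"] field_simps)
    with Suc show ?case by (simp add: algebra_simps)
  qed (simp add: sqrt_coeff_Suc)
  also have "\<dots> \<ge> 0" by (intro mult_nonpos_nonpos sqrt_coeff_nonpos) auto
  finally show ?thesis .
qed

lemma sqrt_coeff_abs_sum_le: "(\<Sum>n<m. \<bar>sqrt_coeff (Suc n)\<bar>) \<le> 1"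
proof -
  have "(\<Sum>n\<le>m. sqrt_coeff n) = 1 + (\<Sum>n<m. sqrt_coeff (Suc n))"
    by (subst sum.atMost_shift) simp
  moreover have "(\<Sum>n<m. \<bar>sqrt_coeff (Suc n)\<bar>) = - (\<Sum>n<m. sqrt_coeff (Suc n))"
    using sqrt_coeff_nonpos by (simp add: abs_of_nonpos flip: sum_negf)
  ultimately show ?thesis using sqrt_coeff_sum_nonneg[of m] by simp
qed

lemma summable_sqrt_coeff_Suc: "summable (\<lambda>n. \<bar>sqrt_coeff (Suc n)\<bar>)"
  by (rule summableI_nonneg_bounded[of _ 1]) (auto simp: sqrt_coeff_abs_sum_le)

lemma summable_abs_sqrt_coeff: "summable (\<lambda>n. \<bar>sqrt_coeff n\<bar>)"
  using summable_sqrt_coeff_Suc by (subst (asm) summable_Suc_iff)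

text \<open>These are the coefficients of the square of the series of sqrt(1 - x), that is, of 1 -
  x. Vandermonde's identity with 1/2 + 1/2 = 1 computes them.\<close>

lemma sqrt_coeff_convolution:
  "(\<Sum>i\<le>k. sqrt_coeff i * sqrt_coeff (k - i)) = (if k = 0 then 1 else if k = 1 then -1 else 0)"
proof -
  have "(\<Sum>i\<le>k. sqrt_coeff i * sqrt_coeff (k - i))
    = (\<Sum>i=0..k. (-1)^k * (((1/2) gchoose i) * ((1/2) gchoose (k - i))))"
    unfolding atMost_atLeast0 sqrt_coeff_def
    by (rule sum.cong) (auto simp: mult_ac simp flip: power_add)
  also have "\<dots> = (-1)^k * (of_nat 1 gchoose k)"
    by (subst sum_distrib_left[symmetric], subst gbinomial_Vandermonde) simp
  also have "\<dots> = (if k = 0 then 1 else if k = 1 then -1 else 0)"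
    by (subst binomial_gbinomial[symmetric]) auto
  finally show ?thesis .
qed

text \<open>The double family \<open>h\<close> is absolutely summable, so its sum \<open>S\<close>
  may be taken by rows or along antidiagonals. With \<open>f\<close> the orbit of a vector under
  \<open>X\<close>, this multiplies power series in \<open>X\<close>.\<close>

lemma Cauchy_product_scaleR:
  fixes f :: "nat \<Rightarrow> 'a::banach" and c :: "nat \<Rightarrow> real"
  assumes c: "summable (\<lambda>n. \<bar>c n\<bar>)" and f: "\<And>n. norm (f n) \<le> K"
  shows "(\<Sum>m. c m *\<^sub>R (\<Sum>n. c n *\<^sub>R f (m + n))) = (\<Sum>k. (\<Sum>i\<le>k. c i * c (k - i)) *\<^sub>R f k)"
proof -
  define h where "h = (\<lambda>(m, n). (c m * c n) *\<^sub>R f (m + n))"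
  have c': "((\<lambda>n. \<bar>c n\<bar>) has_sum (\<Sum>n. \<bar>c n\<bar>)) UNIV"
    using norm_summable_imp_has_sum[of "\<lambda>n. \<bar>c n\<bar>"] c by (simp add: summable_sums)
  then have "(\<lambda>n. \<bar>c n\<bar>) summable_on UNIV" by (rule has_sum_imp_summable)
  then have "(\<lambda>p. \<bar>c (fst p)\<bar> * \<bar>c (snd p)\<bar>) summable_on UNIV \<times> UNIV"
    by (intro summable_on_SigmaI[where g = "\<lambda>m. \<bar>c m\<bar> * (\<Sum>n. \<bar>c n\<bar>)"])
       (auto intro!: has_sum_cmult_right summable_on_cmult_left c')
  then have "(\<lambda>p. \<bar>c (fst p)\<bar> * \<bar>c (snd p)\<bar> * K) summable_on UNIV \<times> UNIV"
    by (rule summable_on_cmult_left)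
  then have "(\<lambda>p. norm (h p)) summable_on UNIV \<times> UNIV"
    by (rule summable_on_comparison_test)
       (auto simp: h_def abs_mult intro!: mult_left_mono f)
  then obtain S where S: "(h has_sum S) (UNIV \<times> UNIV)"
    using abs_summable_summable summable_on_def by blast
  have "(\<lambda>m. c m *\<^sub>R (\<Sum>n. c n *\<^sub>R f (m + n))) sums S"
  proof (rule has_sum_imp_sums, rule has_sum_SigmaD[OF S])
    fix m
    have "summable (\<lambda>n. norm (c n *\<^sub>R f (m + n)))"
      by (rule summable_comparison_test'[OF summable_mult2[OF c, of K]])
         (auto intro!: mult_left_mono f)
    then have "((\<lambda>n. c n *\<^sub>R f (m + n)) has_sum (\<Sum>n. c n *\<^sub>R f (m + n))) UNIV"
      by (intro norm_summable_imp_has_sum summable_sums) (auto intro: summable_norm_cancel)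
    from has_sum_scaleR[OF this, of "c m"]
    show "((\<lambda>n. h (m, n)) has_sum c m *\<^sub>R (\<Sum>n. c n *\<^sub>R f (m + n))) UNIV"
      by (simp add: h_def)
  qed
  moreover have "(\<lambda>k. (\<Sum>i\<le>k. c i * c (k - i)) *\<^sub>R f k) sums S"
  proof (rule has_sum_imp_sums, rule has_sum_SigmaD)
    \<comment> \<open>Reindex the pairs by their sum \<open>k\<close> and first entry
      \<open>i\<close>.\<close>
    have "bij_betw (\<lambda>(k, i). (i, k - i)) (SIGMA k:UNIV. {..k::nat}) (UNIV \<times> UNIV)"
      by (rule bij_betwI[where g = "\<lambda>(i, j). (i + j, i)"]) auto
    from has_sum_reindex_bij_betw[OF this, of h S] S
    show "((\<lambda>p. h (case p of (k, i) \<Rightarrow> (i, k - i))) has_sum S) (SIGMA k:UNIV. {..k})"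
      by simp
    show "((\<lambda>i. h (case (k, i) of (k, i) \<Rightarrow> (i, k - i))) has_sum
        (\<Sum>i\<le>k. c i * c (k - i)) *\<^sub>R f k) {..k}" for k
      by (rule has_sum_finiteI) (auto simp: h_def scaleR_sum_left)
  qed
  ultimately show ?thesis by (simp add: sums_iff)
qed

section \<open>The binomial series of sqrt(I - X) for a contraction \<open>X\<close>\<close>

definition sqrt_series :: "('a::complex_hilbert_space \<Rightarrow> 'a) \<Rightarrow> 'a \<Rightarrow> 'a"
  where "sqrt_series X x = (\<Sum>n. sqrt_coeff n *\<^sub>R (X ^^ n) x)"

context
  fixes X :: "'a::complex_hilbert_space \<Rightarrow> 'a"
  assumes X: "bounded_clinear X" and norm_X: "\<And>x. norm (X x) \<le> norm x"
begin

lemma bounded_clinear_funpow: "bounded_clinear (X ^^ n)"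
proof (induction n)
  case (Suc n)
  then show ?case using bounded_clinear_compose[OF X, of "X ^^ n"] by (simp add: comp_def)
qed (simp add: bounded_clinear_id id_def)

lemma norm_funpow_le: "norm ((X ^^ n) x) \<le> norm x"
  by (induction n) (auto intro: order_trans[OF norm_X])

lemma summable_norm_sqrt_series: "summable (\<lambda>n. norm (sqrt_coeff n *\<^sub>R (X ^^ n) x))"
  by (rule summable_comparison_test'[OF summable_mult2[OF summable_abs_sqrt_coeff, of "norm x"]])
     (auto intro!: mult_left_mono norm_funpow_le)

lemmas summable_sqrt_series = summable_norm_cancel[OF summable_norm_sqrt_series]

lemma bounded_linear_sqrt_series:
  assumes "bounded_linear B"
  shows "B (sqrt_series X x) = (\<Sum>n. sqrt_coeff n *\<^sub>R B ((X ^^ n) x))"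
  unfolding sqrt_series_def
  by (simp add: bounded_linear.suminf[OF assms summable_sqrt_series] linear_simps[OF assms])

lemma bounded_clinear_sqrt_series: "bounded_clinear (sqrt_series X)"
proof (rule bounded_clinearI[of _ "\<Sum>n. \<bar>sqrt_coeff n\<bar>"])
  show "sqrt_series X (x + y) = sqrt_series X x + sqrt_series X y" for x y
    unfolding sqrt_series_def
    by (simp add: suminf_add[OF summable_sqrt_series summable_sqrt_series]
        bounded_clinear_simps[OF bounded_clinear_funpow] scaleR_add_right)
  show "sqrt_series X (c *\<^sub>C x) = c *\<^sub>C sqrt_series X x" for c x
  proof -
    from bounded_linear_sqrt_series[OF bounded_linear_scaleC] show ?thesis
      by (simp add: sqrt_series_def bounded_clinear_simps[OF bounded_clinear_funpow])
  qed
  show "norm (sqrt_series X x) \<le> norm x * (\<Sum>n. \<bar>sqrt_coeff n\<bar>)" for x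
  proof -
    have "norm (sqrt_series X x) \<le> (\<Sum>n. norm (sqrt_coeff n *\<^sub>R (X ^^ n) x))"
      unfolding sqrt_series_def by (rule summable_norm[OF summable_norm_sqrt_series])
    also have "\<dots> \<le> (\<Sum>n. \<bar>sqrt_coeff n\<bar> * norm x)"
      by (intro suminf_le summable_norm_sqrt_series summable_mult2 summable_abs_sqrt_coeff)
         (auto intro!: mult_left_mono norm_funpow_le)
    finally show ?thesis
      by (simp add: mult.commute[of "norm x"] flip: suminf_mult2[OF summable_abs_sqrt_coeff])
  qed
qed

lemma sqrt_series_squared: "sqrt_series X (sqrt_series X x) = x - X x"
proof -
  have "sqrt_series X (sqrt_series X x)
      = (\<Sum>m. sqrt_coeff m *\<^sub>R (\<Sum>n. sqrt_coeff n *\<^sub>R (X ^^ (m + n)) x))"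
    using bounded_linear_sqrt_series[OF bounded_clinear_bounded_linear[OF bounded_clinear_funpow]]
    by (subst sqrt_series_def) (simp add: funpow_add)
  also have "\<dots> = (\<Sum>k. (if k = 0 then 1 else if k = 1 then -1 else 0) *\<^sub>R (X ^^ k) x)"
    by (subst Cauchy_product_scaleR[OF summable_abs_sqrt_coeff norm_funpow_le])
       (simp only: sqrt_coeff_convolution)
  also have "\<dots> = (\<Sum>k\<in>{0, 1}. (if k = 0 then 1 else if k = 1 then -1 else 0) *\<^sub>R (X ^^ k) x)"
    by (rule suminf_finite) auto
  finally show ?thesis by simp
qed

text \<open>\<open>B\<close> commutes with all powers of \<open>X\<close> and, being continuous,
  with their series. Uniqueness of square roots rests on this.\<close>

lemma sqrt_series_commute:
  assumes "bounded_linear B" "\<And>x. B (X x) = X (B x)"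
  shows "B (sqrt_series X x) = sqrt_series X (B x)"
proof -
  have "B ((X ^^ n) x) = (X ^^ n) (B x)" for n
    by (induction n) (auto simp: assms(2))
  then show ?thesis
    by (simp add: bounded_linear_sqrt_series[OF assms(1)]) (simp add: sqrt_series_def)
qed

text \<open>All coefficients but the first are nonpositive, and their absolute values sum to at most 1.\<close>

lemma positive_op_sqrt_series:
  assumes P: "positive_op X"
  shows "positive_op (sqrt_series X)"
proof (rule positive_opI[OF bounded_clinear_sqrt_series])
  fix x
  have pow: "cinner ((X ^^ n) x) y = cinner x ((X ^^ n) y)" for n x y
    by (induction n arbitrary: x y)
       (simp_all add: positive_op_selfadjoint[OF P] funpow_swap1)
  have real: "Im (cinner ((X ^^ n) x) x) = 0" for n
    using pow[of n x x] cinner_commute[of "(X ^^ n) x" x] by (simp add: complex_eq_iff)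
  have le: "\<bar>Re (cinner ((X ^^ n) x) x)\<bar> \<le> (norm x)\<^sup>2" for n
  proof -
    have "\<bar>Re (cinner ((X ^^ n) x) x)\<bar> \<le> norm ((X ^^ n) x) * norm x"
      using abs_Re_le_cmod norm_cinner_le order_trans by blast
    also have "\<dots> \<le> norm x * norm x" by (intro mult_right_mono norm_funpow_le) auto
    finally show ?thesis by (simp add: power2_eq_square)
  qed
  define a where "a n = Re (cinner ((X ^^ n) x) x)" for n
  have "(\<lambda>n. cinner (sqrt_coeff n *\<^sub>R (X ^^ n) x) x) sums cinner (sqrt_series X x) x"
    unfolding sqrt_series_def
    by (intro bounded_linear.sums[OF bounded_bilinear.bounded_linear_left[OF bounded_bilinear_cinner]]
        summable_sums summable_sqrt_series)
  moreover have "cinner (sqrt_coeff n *\<^sub>R (X ^^ n) x) x = of_real (sqrt_coeff n * a n)" for n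
    using real by (simp add: cinner_simps complex_eq_iff a_def)
  ultimately have "(\<lambda>n. complex_of_real (sqrt_coeff n * a n)) sums cinner (sqrt_series X x) x"
    by simp
  then have Re: "(\<lambda>n. sqrt_coeff n * a n) sums Re (cinner (sqrt_series X x) x)"
    and Im: "(\<lambda>n. 0) sums Im (cinner (sqrt_series X x) x)"
    by (auto simp: sums_complex_iff)
  have "Im (cinner (sqrt_series X x) x) = 0" using Im sums_unique2 sums_zero by blast
  moreover have "Re (cinner (sqrt_series X x) x) \<ge> 0"
  proof (rule LIMSEQ_le_const)
    \<comment> \<open>The shift to \<open>Suc n\<close> keeps index 0 in every partial sum; its term
      \<open>(norm x)\<^sup>2\<close> dominates the other \<open>n\<close> terms.\<close>
    show "(\<lambda>n. \<Sum>i<Suc n. sqrt_coeff i * a i) \<longlonglongrightarrow> Re (cinner (sqrt_series X x) x)"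
      using Re unfolding sums_def by (rule LIMSEQ_Suc)
    have "0 \<le> (\<Sum>i<Suc n. sqrt_coeff i * a i)" for n
    proof -
      have "(\<Sum>i<n. - (sqrt_coeff (Suc i) * a (Suc i))) \<le> (\<Sum>i<n. \<bar>sqrt_coeff (Suc i)\<bar> * (norm x)\<^sup>2)"
      proof (rule sum_mono)
        fix i
        have "- (sqrt_coeff (Suc i) * a (Suc i)) \<le> \<bar>sqrt_coeff (Suc i)\<bar> * \<bar>a (Suc i)\<bar>"
          by (simp flip: abs_mult)
        also have "\<dots> \<le> \<bar>sqrt_coeff (Suc i)\<bar> * (norm x)\<^sup>2"
          unfolding a_def by (intro mult_left_mono le) auto
        finally show "- (sqrt_coeff (Suc i) * a (Suc i)) \<le> \<bar>sqrt_coeff (Suc i)\<bar> * (norm x)\<^sup>2" .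
      qed
      also have "\<dots> \<le> 1 * (norm x)\<^sup>2"
        by (subst sum_distrib_right[symmetric]) (intro mult_right_mono sqrt_coeff_abs_sum_le, auto)
      also have "\<dots> = a 0" by (simp add: a_def cinner_self)
      finally show ?thesis by (simp add: sum.lessThan_Suc_shift sum_negf del: sum.lessThan_Suc)
    qed
    then show "\<exists>N. \<forall>n\<ge>N. 0 \<le> (\<Sum>i<Suc n. sqrt_coeff i * a i)" by blast
  qed
  ultimately show "\<exists>r\<ge>0. cinner (sqrt_series X x) x = of_real r"
    by (intro exI[of _ "Re (cinner (sqrt_series X x) x)"]) (simp add: complex_eq_iff)
qed

end

section \<open>Existence and uniqueness of positive square roots\<close>

lemma positive_sqrt_exists:
  fixes A :: "'a::complex_hilbert_space \<Rightarrow> 'a"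
  assumes A: "positive_op A"
  shows "\<exists>P. positive_op P \<and> P \<circ> P = A \<and>
    (\<forall>B. bounded_linear B \<longrightarrow> B \<circ> A = A \<circ> B \<longrightarrow> B \<circ> P = P \<circ> B)"
proof -
  note L = positive_op_bounded_clinear[OF A]
  \<comment> \<open>The summand 1 keeps the scale positive when \<open>A\<close> is zero.\<close>
  define a where "a = onorm A + 1"
  have a: "a > 0" using onorm_pos_le[OF bounded_clinear_bounded_linear[OF L]] by (simp add: a_def)
  \<comment> \<open>Since \<open>A\<close> is \<open>a\<close> times I - X, its root is
    \<open>sqrt a\<close> times the series, provided that \<open>X\<close> is a positive
    contraction.\<close>
  define X where "X x = x - (1 / a) *\<^sub>R A x" for x
  have X: "bounded_clinear X"
    unfolding X_def
    by (intro bounded_clinear_diff_fun bounded_clinear_id bounded_clinear_scaleR_fun L)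
  have cinner_X: "cinner (X x) x = of_real ((norm x)\<^sup>2 - Re (cinner (A x) x) / a)" for x
    using positive_op_cinner(1)[OF A, of x]
    by (simp add: X_def cinner_simps cinner_self complex_eq_iff)
  have "Re (cinner (A x) x) \<le> a * (norm x)\<^sup>2" for x
  proof -
    have "Re (cinner (A x) x) \<le> norm (A x) * norm x"
      using complex_Re_le_cmod norm_cinner_le order_trans by blast
    also have "\<dots> \<le> a * norm x * norm x"
      using bounded_clinear_norm_le[OF L, of x]
      by (intro mult_right_mono) (auto simp: a_def distrib_right add_increasing2)
    finally show ?thesis by (simp add: power2_eq_square)
  qed
  then have "(norm x)\<^sup>2 - Re (cinner (A x) x) / a \<ge> 0" for x
    using a by (simp add: field_simps)
  with cinner_X have X_pos: "positive_op X" by (intro positive_opI X) blast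
  have norm_X: "norm (X x) \<le> norm x" for x
    by (rule positive_op_norm_le[OF X_pos])
       (use a positive_op_cinner(2)[OF A] in \<open>simp add: cinner_X\<close>)
  define P where "P x = sqrt a *\<^sub>R sqrt_series X x" for x
  have lin: "bounded_clinear (sqrt_series X)"
    by (rule bounded_clinear_sqrt_series[OF X norm_X])
  have "positive_op P"
  proof (rule positive_opI)
    show "bounded_clinear P" unfolding P_def by (rule bounded_clinear_scaleR_fun[OF lin])
    show "\<exists>r\<ge>0. cinner (P x) x = of_real r" for x
      using positive_op_cinner[OF positive_op_sqrt_series[OF X norm_X X_pos], of x] a
      by (intro exI[of _ "sqrt a * Re (cinner (sqrt_series X x) x)"])
         (simp add: P_def cinner_simps complex_eq_iff)
  qed
  moreover have "P (P x) = A x" for x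
    using a by (simp add: P_def bounded_clinear_simps[OF lin] sqrt_series_squared[OF X norm_X])
      (simp add: X_def)
  moreover have "B (P x) = P (B x)" if B: "bounded_linear B" "\<And>x. B (A x) = A (B x)" for B x
  proof -
    have "B (sqrt_series X x) = sqrt_series X (B x)"
      by (rule sqrt_series_commute[OF X norm_X B(1)]) (simp add: X_def linear_simps[OF B(1)] B(2))
    then show ?thesis by (simp add: P_def linear_simps[OF B(1)])
  qed
  ultimately show ?thesis by (intro exI[of _ P]) (auto simp: fun_eq_iff)
qed

text \<open>For y = Px - Qx commutation gives (P + Q)y = P^2 x - Q^2 x = 0. Both forms are
  nonnegative, so both vanish at \<open>y\<close>; hence \<open>P y = 0\<close> and
  \<open>Q y = 0\<close>, and self-adjointness makes \<open>y\<close> orthogonal to itself.\<close>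

lemma commuting_positive_sqrt_unique:
  assumes P: "positive_op P" and Q: "positive_op Q"
    and sq: "P \<circ> P = Q \<circ> Q" and comm: "P \<circ> Q = Q \<circ> P"
  shows "P = Q"
proof
  fix x
  note LP = positive_op_bounded_clinear[OF P] and LQ = positive_op_bounded_clinear[OF Q]
  define y where "y = P x - Q x"
  have "P y + Q y = 0"
    using sq comm by (simp add: y_def bounded_clinear_simps[OF LP] bounded_clinear_simps[OF LQ] fun_eq_iff)
  then have "cinner (P y) y + cinner (Q y) y = 0"
    by (metis cinner_add_left cinner_zero_left)
  then have "Re (cinner (P y) y) = 0" "Re (cinner (Q y) y) = 0"
    using positive_op_cinner(2)[OF P, of y] positive_op_cinner(2)[OF Q, of y]
    by (auto simp: complex_eq_iff)
  then have "cinner (P y) y = 0" "cinner (Q y) y = 0"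
    using positive_op_cinner(1)[OF P, of y] positive_op_cinner(1)[OF Q, of y] by auto
  then have "P y = 0" "Q y = 0" using positive_op_eq_0 P Q by blast+
  have "cinner y y = cinner (P x) y - cinner (Q x) y"
    by (simp add: y_def cinner_simps)
  also have "\<dots> = 0"
    using \<open>P y = 0\<close> \<open>Q y = 0\<close> by (simp add: positive_op_selfadjoint[OF P] positive_op_selfadjoint[OF Q])
  finally show "P x = Q x" by (simp add: cinner_self_eq_0 y_def)
qed

lemma positive_sqrt_unique:
  assumes P: "positive_op P" and Q: "positive_op Q" and sq: "P \<circ> P = Q \<circ> Q"
  shows "P = Q"
proof -
  have "positive_op (Q \<circ> Q)"
  proof (rule positive_opI)
    show "bounded_clinear (Q \<circ> Q)"
      using bounded_clinear_compose positive_op_bounded_clinear Q by blast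
    show "\<exists>r\<ge>0. cinner ((Q \<circ> Q) x) x = of_real r" for x
      by (intro exI[of _ "(norm (Q x))\<^sup>2"]) (simp add: positive_op_selfadjoint[OF Q] cinner_self)
  qed
  then obtain R where R: "positive_op R" "R \<circ> R = Q \<circ> Q"
    and comm: "\<And>B. bounded_linear B \<Longrightarrow> B \<circ> (Q \<circ> Q) = Q \<circ> Q \<circ> B \<Longrightarrow> B \<circ> R = R \<circ> B"
    using positive_sqrt_exists by blast
  \<comment> \<open>Any root \<open>S\<close> commutes with its own square, hence with
    \<open>R\<close>, so the commuting case applies. Both \<open>P\<close> and \<open>Q\<close> are
    such roots.\<close>
  have "S = R" if S: "positive_op S" "S \<circ> S = Q \<circ> Q" for S
  proof (rule commuting_positive_sqrt_unique[OF S(1) R(1)])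
    show "S \<circ> R = R \<circ> S"
      by (rule comm[OF bounded_clinear_bounded_linear[OF positive_op_bounded_clinear[OF S(1)]]])
         (simp add: comp_assoc flip: S(2))
  qed (simp add: S R)
  then show ?thesis using P Q sq by metis
qed

section \<open>Absolute values of operators\<close>

lemma sqrt_op_eqI:
  assumes "positive_op P" "P \<circ> P = A"
  shows "sqrt_op A = P"
  unfolding sqrt_op_def using assms by (blast intro: positive_sqrt_unique)

lemma
  assumes A: "bounded_clinear A"
  shows positive_op_abs_op: "positive_op (abs_op A)"
    and abs_op_abs_op: "abs_op A (abs_op A x) = cadjoint A (A x)"
  using positive_sqrt_exists[OF positive_op_cadjoint_compose[OF A]] sqrt_op_eqI
  unfolding abs_op_def by (metis comp_apply)+

lemma abs_op_eqI:
  assumes "positive_op P" "\<And>x. P (P x) = cadjoint A (A x)"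
  shows "abs_op A = P"
  unfolding abs_op_def using assms by (intro sqrt_op_eqI) auto

lemma bounded_clinear_abs_op: "bounded_clinear A \<Longrightarrow> bounded_clinear (abs_op A)"
  using positive_op_bounded_clinear positive_op_abs_op by blast

text \<open>Both squared norms are the quadratic form of \<open>cadjoint A \<circ> A\<close> at
  \<open>x\<close>.\<close>

lemma norm_abs_op:
  assumes A: "bounded_clinear A"
  shows "norm (abs_op A x) = norm (A x)"
proof -
  have "cinner (abs_op A x) (abs_op A x) = cinner (A x) (A x)"
    by (simp add: positive_op_selfadjoint[OF positive_op_abs_op[OF A]] abs_op_abs_op[OF A]
        cinner_cadjoint[OF A])
  then show ?thesis by (simp add: cinner_self flip: of_real_power)
qed

lemma onorm_abs_op: "bounded_clinear A \<Longrightarrow> onorm (abs_op A) = onorm A"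
  unfolding onorm_def by (simp add: norm_abs_op)


subsection \<open>Polar decomposition\<close>

lemma closure_range_limit:
  assumes "z \<in> closure (range (A :: 'a::complex_hilbert_space \<Rightarrow> 'a))"
  obtains x where "(\<lambda>n. A (x n)) \<longlonglongrightarrow> z"
proof -
  obtain u where "\<And>n. u n \<in> range A" "u \<longlonglongrightarrow> z"
    using assms unfolding closure_sequential by blast
  then have "\<forall>n. \<exists>x. u n = A x" by blast
  then obtain x where "\<And>n. u n = A (x n)" by metis
  then have "u = (\<lambda>n. A (x n))" by auto
  with \<open>u \<longlonglongrightarrow> z\<close> that show thesis by simp
qed

lemma orthogonal_closure_range:
  assumes "z \<in> closure (range (A :: 'a::complex_hilbert_space \<Rightarrow> 'a))" and "\<And>x. cinner (A x) w = 0"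
  shows "cinner z w = 0"
proof -
  obtain x where "(\<lambda>n. A (x n)) \<longlonglongrightarrow> z" using closure_range_limit[OF assms(1)] .
  then have "(\<lambda>n. cinner (A (x n)) w) \<longlonglongrightarrow> cinner z w" by (intro tendsto_intros)
  then show ?thesis by (simp add: assms(2) LIMSEQ_const_iff)
qed

context
  fixes T :: "'a::complex_hilbert_space \<Rightarrow> 'a"
  assumes T: "bounded_clinear T"
begin

lemma abs_op_selfadjoint: "cinner (abs_op T x) y = cinner x (abs_op T y)"
  by (rule positive_op_selfadjoint[OF positive_op_abs_op[OF T]])

lemma abs_op_eq_0_iff: "abs_op T x = 0 \<longleftrightarrow> T x = 0"
  by (metis norm_abs_op[OF T] norm_eq_zero)

text \<open>The orthogonal complement of the range of the self-adjoint \<open>abs_op T\<close> is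
  its kernel, which is that of \<open>T\<close>.\<close>

lemma orthogonal_range_abs_op:
  assumes "\<And>x. cinner (abs_op T x) y = 0"
  shows "T y = 0"
  using assms cinner_eqI_right[of "abs_op T y" 0] by (simp add: abs_op_selfadjoint abs_op_eq_0_iff)

text \<open>Split \<open>y\<close> into its projection \<open>p\<close> onto the closed range of
  \<open>abs_op T\<close> and a rest in the kernel of \<open>T\<close>. On \<open>p\<close> both
  maps are the limit of the same vectors \<open>T (x n)\<close>; on the rest both vanish.\<close>

lemma polar_decomposition_unique:
  assumes U: "bounded_clinear U" "T = U \<circ> abs_op T" "{x. U x = 0} = {x. T x = 0}"
    and V: "bounded_clinear V" "T = V \<circ> abs_op T" "{x. V x = 0} = {x. T x = 0}"
  shows "U = V"
proof
  fix y
  obtain p where p: "p \<in> closure (range (abs_op T))" "\<And>x. cinner (abs_op T x) (y - p) = 0"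
    using projection_closure_range[OF bounded_clinear_abs_op[OF T]] by blast
  from closure_range_limit[OF p(1)] obtain x where x: "(\<lambda>n. abs_op T (x n)) \<longlonglongrightarrow> p" .
  have "(\<lambda>n. T (x n)) \<longlonglongrightarrow> W p" if "bounded_clinear W" "T = W \<circ> abs_op T" for W
  proof -
    have "T (x n) = W (abs_op T (x n))" for n using that(2) by (metis comp_apply)
    then show ?thesis
      using bounded_linear.tendsto[OF bounded_clinear_bounded_linear[OF that(1)] x] by simp
  qed
  then have "U p = V p" using U(1,2) V(1,2) LIMSEQ_unique by blast
  moreover have "T (y - p) = 0" by (rule orthogonal_range_abs_op[OF p(2)])
  then have "U (y - p) = 0" "V (y - p) = 0" using U(3) V(3) by auto
  ultimately show "U y = V y"
    by (simp add: bounded_clinear_simps[OF U(1)] bounded_clinear_simps[OF V(1)])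
qed

lemma polar_decomposition_exists:
  "\<exists>U. partial_isometry U \<and> T = U \<circ> abs_op T \<and> {x. U x = 0} = {x. T x = 0} \<and>
    (\<forall>x. norm (U x) \<le> norm x) \<and> (\<forall>x y. cinner (T x) (U y) = cinner (abs_op T x) y)"
proof -
  let ?R = "abs_op T"
  note R = bounded_clinear_abs_op[OF T]
  \<comment> \<open>The functional \<open>cinner (abs_op T x) y\<close> is controlled by
    \<open>norm (T x)\<close>, so it is represented through \<open>T\<close>; \<open>U y\<close>
    will be the representing vector.\<close>
  have "\<exists>z. z \<in> closure (range T) \<and> norm z \<le> norm y \<and> (\<forall>x. cinner (?R x) y = cinner (T x) z)" for y
  proof (rule functional_representation[OF T, of "\<lambda>x. cinner (?R x) y" "norm y"])
    show "cmod (cinner (?R x) y) \<le> norm y * norm (T x)" for x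
      using norm_cinner_le[of "?R x" y] by (simp add: norm_abs_op[OF T] mult.commute)
  qed (auto simp: bounded_clinear_simps[OF R] cinner_simps)
  then obtain U where U_closure: "\<And>y. U y \<in> closure (range T)"
    and U_le: "\<And>y. norm (U y) \<le> norm y"
    and U: "\<And>x y. cinner (T x) (U y) = cinner (?R x) y"
    by metis
  \<comment> \<open>All values of \<open>U\<close> lie in the closed range of \<open>T\<close>.
    Below, a difference \<open>w\<close> of such vectors is shown orthogonal to the range of
    \<open>T\<close>, hence to itself, and so is zero.\<close>
  have U_orth: "cinner (U y) w = 0" if "\<And>x. cinner (T x) w = 0" for y w
    by (rule orthogonal_closure_range[OF U_closure that])
  have UR: "U (?R x) = T x" for x
  proof -
    define w where "w = U (?R x) - T x"
    have w: "cinner (T z) w = 0" for z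
      unfolding w_def
      by (simp add: cinner_diff_right U)
        (simp add: abs_op_selfadjoint abs_op_abs_op[OF T] cinner_cadjoint[OF T])
    have "cinner w w = cinner (U (?R x)) w - cinner (T x) w"
      by (subst w_def) (simp add: cinner_simps)
    then have "w = 0" by (simp add: U_orth w cinner_self_eq_0)
    then show ?thesis by (simp add: w_def)
  qed
  have lin: "bounded_clinear U"
  proof (rule bounded_clinearI[of _ 1])
    fix x y
    define w where "w = U (x + y) - (U x + U y)"
    have w: "cinner (T z) w = 0" for z
      by (simp add: w_def cinner_simps U)
    have "cinner w w = cinner (U (x + y)) w - (cinner (U x) w + cinner (U y) w)"
      by (subst w_def) (simp add: cinner_simps)
    then have "w = 0" by (simp add: U_orth w cinner_self_eq_0)
    then show "U (x + y) = U x + U y" by (simp add: w_def)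
  next
    fix c x
    define w where "w = U (c *\<^sub>C x) - c *\<^sub>C U x"
    have w: "cinner (T z) w = 0" for z
      by (simp add: w_def cinner_simps U)
    have "cinner w w = cinner (U (c *\<^sub>C x)) w - c * cinner (U x) w"
      by (subst w_def) (simp add: cinner_simps)
    then have "w = 0" by (simp add: U_orth w cinner_self_eq_0)
    then show "U (c *\<^sub>C x) = c *\<^sub>C U x" by (simp add: w_def)
  qed (simp add: U_le)
  have kernel: "U y = 0 \<longleftrightarrow> T y = 0" for y
  proof
    assume "U y = 0"
    then have "cinner (?R x) y = 0" for x using U[of x y] by simp
    then show "T y = 0" by (rule orthogonal_range_abs_op)
  next
    assume "T y = 0"
    then have "cinner (T x) (U y) = 0" for x
      by (simp add: U abs_op_selfadjoint abs_op_eq_0_iff[THEN iffD2])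
    then show "U y = 0" using U_orth cinner_self_eq_0 by blast
  qed
  \<comment> \<open>A vector orthogonal to the kernel of \<open>U\<close> equals its projection
    \<open>p\<close>, hence is a limit of vectors \<open>abs_op T (u n)\<close>, whose norms
    \<open>U\<close> preserves by \<open>UR\<close> and \<open>norm_abs_op\<close>.\<close>
  have "norm (U x) = norm x" if x: "\<And>y. U y = 0 \<Longrightarrow> cinner x y = 0" for x
  proof -
    obtain p where p: "p \<in> closure (range ?R)" "\<And>z. cinner (?R z) (x - p) = 0"
      using projection_closure_range[OF R] by blast
    have "U (x - p) = 0" using kernel orthogonal_range_abs_op[OF p(2)] by simp
    then have "cinner x (x - p) = 0" by (rule x)
    moreover have "cinner p (x - p) = 0" by (rule orthogonal_closure_range[OF p])
    ultimately have "cinner (x - p) (x - p) = 0" by (subst cinner_diff_left) simp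
    then have "x = p" by (simp add: cinner_self_eq_0)
    with p(1) obtain u where u: "(\<lambda>n. ?R (u n)) \<longlonglongrightarrow> x" using closure_range_limit by blast
    have "(\<lambda>n. norm (U (?R (u n)))) \<longlonglongrightarrow> norm (U x)"
      by (intro tendsto_norm bounded_linear.tendsto[OF bounded_clinear_bounded_linear[OF lin] u])
    then have "(\<lambda>n. norm (?R (u n))) \<longlonglongrightarrow> norm (U x)" by (simp add: UR norm_abs_op[OF T])
    then show ?thesis using tendsto_norm[OF u] LIMSEQ_unique by blast
  qed
  then have "partial_isometry U" by (simp add: partial_isometry_def lin)
  with UR kernel U_le U show ?thesis by (intro exI[of _ U]) (auto simp: fun_eq_iff)
qed

lemma
  shows bounded_clinear_polar_part: "bounded_clinear (polar_part T)"
    and norm_polar_part_le: "norm (polar_part T x) \<le> norm x"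
    and polar_part_abs_op: "polar_part T (abs_op T x) = T x"
    and cinner_polar_part: "cinner (T x) (polar_part T y) = cinner (abs_op T x) y"
proof -
  obtain U where U: "partial_isometry U" "T = U \<circ> abs_op T" "{x. U x = 0} = {x. T x = 0}"
    "\<And>x. norm (U x) \<le> norm x" "\<And>x y. cinner (T x) (U y) = cinner (abs_op T x) y"
    using polar_decomposition_exists by blast
  have lin: "bounded_clinear V" if "partial_isometry V" for V :: "'a \<Rightarrow> 'a"
    using that by (simp add: partial_isometry_def)
  have "polar_part T = U"
    unfolding polar_part_def
  proof (rule the_equality)
    fix V assume V: "partial_isometry V \<and> T = V \<circ> abs_op T \<and> {x. V x = 0} = {x. T x = 0}"
    show "V = U"
      by (rule polar_decomposition_unique[OF lin _ _ lin[OF U(1)] U(2,3)]) (use V in simp_all)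
  qed (intro conjI U(1-3))
  moreover have "U (abs_op T x) = T x" using U(2) by (metis comp_apply)
  ultimately show "bounded_clinear (polar_part T)" "norm (polar_part T x) \<le> norm x"
    "polar_part T (abs_op T x) = T x" "cinner (T x) (polar_part T y) = cinner (abs_op T x) y"
    using U(4,5) lin[OF U(1)] by auto
qed

lemma bounded_clinear_duggal: "bounded_clinear (duggal T)"
  unfolding duggal_def
  by (rule bounded_clinear_compose[OF bounded_clinear_abs_op[OF T] bounded_clinear_polar_part])

text \<open>\<open>abs_op T\<close> has the same pointwise norms as \<open>T\<close>, and the polar
  part is a contraction.\<close>

lemma onorm_duggal_le: "onorm (duggal T) \<le> onorm T"
proof (rule onorm_bound)
  show pos: "0 \<le> onorm T" by (rule onorm_pos_le[OF bounded_clinear_bounded_linear[OF T]])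
  show "norm (duggal T x) \<le> onorm T * norm x" for x
    using bounded_clinear_norm_le[OF T, of "polar_part T x"]
      mult_left_mono[OF norm_polar_part_le[of x] pos]
    by (simp add: duggal_def norm_abs_op[OF T])
qed

text \<open>With U the polar part and R = |T|, T = UR gives T* = RU*, and
  \<open>cinner_polar_part\<close> gives U*T = R. So URU* squares to UR(U*U)RU* = URRU* =
  TT*.\<close>

lemma abs_op_cadjoint:
  "abs_op (cadjoint T) = (\<lambda>y. polar_part T (abs_op T (cadjoint (polar_part T) y)))"
proof (rule abs_op_eqI)
  let ?U = "polar_part T" and ?R = "abs_op T"
  let ?V = "cadjoint ?U"
  note U = bounded_clinear_polar_part and R = bounded_clinear_abs_op[OF T]
  note V = bounded_clinear_cadjoint[OF U]
  have "bounded_clinear (?U \<circ> (?R \<circ> ?V))"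
    by (intro bounded_clinear_compose U R V)
  moreover have "cinner (?U (?R (?V y))) y = cinner (?R (?V y)) (?V y)" for y
    by (rule cinner_cadjoint[OF U])
  ultimately show "positive_op (\<lambda>y. ?U (?R (?V y)))"
    using positive_op_cinner[OF positive_op_abs_op[OF T]] by (intro positive_opI) (auto simp: comp_def)
  have VT: "?V (T x) = ?R x" for x
    by (rule cinner_eqI) (simp add: cinner_cadjoint_left[OF U] cinner_polar_part)
  have "cadjoint T = (\<lambda>y. ?R (?V y))"
  proof (rule cadjoint_eqI)
    show "bounded_clinear (\<lambda>y. ?R (?V y))"
      using bounded_clinear_compose[OF R V] by (simp add: comp_def)
    show "cinner (T x) y = cinner x (?R (?V y))" for x y
      by (metis polar_part_abs_op cinner_cadjoint[OF U] abs_op_selfadjoint)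
  qed
  then show "?U (?R (?V (?U (?R (?V y))))) = cadjoint (cadjoint T) (cadjoint T y)" for y
    unfolding cadjoint_cadjoint[OF T] by (simp add: polar_part_abs_op VT)
qed


subsection \<open>The norm inequality\<close>

lemma mixed_Cauchy_Schwarz:
  "(cmod (cinner (T x) y))\<^sup>2
    \<le> Re (cinner (abs_op T x) x) * Re (cinner (abs_op (cadjoint T) y) y)"
proof -
  let ?U = "polar_part T"
  have "cinner (T x) y = cinner (abs_op T x) (cadjoint ?U y)"
    by (metis polar_part_abs_op cinner_cadjoint[OF bounded_clinear_polar_part])
  moreover have "cinner (abs_op (cadjoint T) y) y = cinner (abs_op T (cadjoint ?U y)) (cadjoint ?U y)"
    by (simp add: abs_op_cadjoint cinner_cadjoint[OF bounded_clinear_polar_part])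
  ultimately show ?thesis
    using positive_op_Cauchy_Schwarz[OF positive_op_abs_op[OF T]] by simp
qed

lemma mixed_Schwarz_AM_GM:
  "2 * cmod (cinner (T x) y) \<le> Re (cinner (abs_op T x) x) + Re (cinner (abs_op (cadjoint T) y) y)"
proof -
  let ?p = "Re (cinner (abs_op T x) x)" and ?q = "Re (cinner (abs_op (cadjoint T) y) y)"
  have pos: "?p \<ge> 0" "?q \<ge> 0"
    by (intro positive_op_cinner(2) positive_op_abs_op T bounded_clinear_cadjoint)+
  \<comment> \<open>4|<Tx,y>|^2 is at most 4pq, which is at most (p + q)^2.\<close>
  have sq: "(2 * cmod (cinner (T x) y))\<^sup>2 \<le> (?p + ?q)\<^sup>2"
    using mixed_Cauchy_Schwarz[of x y] sum_squares_bound[of ?p ?q]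
    unfolding power_mult_distrib power2_sum by (simp add: mult.assoc)
  show ?thesis using pos by (intro power2_le_imp_le[OF sq]) linarith
qed

end

lemma onorm_convex_combination_le:
  fixes A B :: "'a::complex_hilbert_space \<Rightarrow> 'a"
  assumes A: "bounded_clinear A" and B: "bounded_clinear B" and "0 \<le> a" "0 \<le> b"
  shows "onorm (\<lambda>x. a *\<^sub>R A x + b *\<^sub>R B x) \<le>
    (onorm (\<lambda>x. a *\<^sub>R abs_op A x + b *\<^sub>R abs_op B x)
      + onorm (\<lambda>x. a *\<^sub>R abs_op (cadjoint A) x + b *\<^sub>R abs_op (cadjoint B) x)) / 2"
    (is "onorm ?S \<le> (onorm ?P + onorm ?Q) / 2")
proof (rule onorm_bound)
  have P: "bounded_clinear ?P" and Q: "bounded_clinear ?Q"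
    by (intro bounded_clinear_add_fun bounded_clinear_scaleR_fun bounded_clinear_abs_op
        bounded_clinear_cadjoint A B)+
  show K: "0 \<le> (onorm ?P + onorm ?Q) / 2"
    using onorm_pos_le[OF bounded_clinear_bounded_linear[OF P]]
      onorm_pos_le[OF bounded_clinear_bounded_linear[OF Q]] by simp
  fix x
  show "norm (?S x) \<le> (onorm ?P + onorm ?Q) / 2 * norm x"
  \<comment> \<open>Excluded because \<open>y\<close> divides by \<open>norm (?S x)\<close> and the
    last step cancels \<open>norm x\<close>.\<close>
  proof (cases "?S x = 0 \<or> x = 0")
    case True
    then show ?thesis
      using K by (auto simp: bounded_clinear_simps[OF A] bounded_clinear_simps[OF B])
  next
    case False
    have quad: "Re (cinner (C z) z) \<le> onorm C * (norm z)\<^sup>2" if "bounded_clinear C" for C :: "'a \<Rightarrow> 'a" and z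
    proof -
      have "Re (cinner (C z) z) \<le> norm (C z) * norm z"
        using complex_Re_le_cmod norm_cinner_le order_trans by blast
      also have "\<dots> \<le> onorm C * norm z * norm z"
        by (intro mult_right_mono bounded_clinear_norm_le that) auto
      finally show ?thesis by (simp add: power2_eq_square)
    qed
    define y where "y = (norm x / norm (?S x)) *\<^sub>R ?S x"
    have norm_y: "norm y = norm x" using False by (simp add: y_def)
    \<comment> \<open>Equality holds in Cauchy-Schwarz since \<open>y\<close> is a positive multiple
      of \<open>?S x\<close>.\<close>
    have "2 * (norm (?S x) * norm x) = 2 * Re (cinner (?S x) y)"
      using False by (simp add: y_def cinner_scaleR_right cinner_self power2_eq_square)
    also have "\<dots> \<le> a * (2 * cmod (cinner (A x) y)) + b * (2 * cmod (cinner (B x) y))"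
      using assms(3,4) complex_Re_le_cmod[of "cinner (A x) y"] complex_Re_le_cmod[of "cinner (B x) y"]
      by (simp add: cinner_simps add_mono mult_left_mono)
    also have "\<dots> \<le> Re (cinner (?P x) x) + Re (cinner (?Q y) y)"
      using mult_left_mono[OF mixed_Schwarz_AM_GM[OF A, of x y] assms(3)]
        mult_left_mono[OF mixed_Schwarz_AM_GM[OF B, of x y] assms(4)]
      by (simp add: cinner_simps algebra_simps)
    also have "\<dots> \<le> onorm ?P * (norm x)\<^sup>2 + onorm ?Q * (norm x)\<^sup>2"
      using quad[OF P, of x] quad[OF Q, of y] by (simp add: norm_y)
    finally have "(2 * norm (?S x)) * norm x \<le> ((onorm ?P + onorm ?Q) * norm x) * norm x"
      by (simp add: power2_eq_square algebra_simps)
    then show ?thesis using False by (simp add: mult_le_cancel_right)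
  qed
qed

lemma onorm_abs_combination_le:
  fixes A B :: "'a::complex_hilbert_space \<Rightarrow> 'a"
  assumes A: "bounded_clinear A" and B: "bounded_clinear B" and "0 \<le> a" "0 \<le> b"
  shows "onorm (\<lambda>x. a *\<^sub>R abs_op A x + b *\<^sub>R abs_op B x) \<le> a * onorm A + b * onorm B"
proof -
  have lin: "bounded_linear (abs_op A)" "bounded_linear (abs_op B)"
    using A B bounded_clinear_abs_op bounded_clinear_bounded_linear by blast+
  have "onorm (\<lambda>x. a *\<^sub>R abs_op A x + b *\<^sub>R abs_op B x)
      \<le> onorm (\<lambda>x. a *\<^sub>R abs_op A x) + onorm (\<lambda>x. b *\<^sub>R abs_op B x)"
    by (intro onorm_triangle bounded_linear_const_scaleR lin)
  then show ?thesis
    using assms by (simp add: onorm_scaleR lin onorm_abs_op)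
qed

lemma onorm_abs_combinations_mean_le:
  fixes A B :: "'a::complex_hilbert_space \<Rightarrow> 'a"
  assumes A: "bounded_clinear A" and B: "bounded_clinear B" and ab: "0 \<le> a" "0 \<le> b"
  shows "(onorm (\<lambda>x. a *\<^sub>R abs_op A x + b *\<^sub>R abs_op B x)
      + onorm (\<lambda>x. a *\<^sub>R abs_op (cadjoint A) x + b *\<^sub>R abs_op (cadjoint B) x)) / 2
    \<le> a * onorm A + b * onorm B"
proof -
  have "onorm (\<lambda>x. a *\<^sub>R abs_op (cadjoint A) x + b *\<^sub>R abs_op (cadjoint B) x)
      \<le> a * onorm (cadjoint A) + b * onorm (cadjoint B)"
    by (rule onorm_abs_combination_le[OF bounded_clinear_cadjoint[OF A] bounded_clinear_cadjoint[OF B] ab])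
  also have "\<dots> \<le> a * onorm A + b * onorm B"
    by (intro add_mono mult_left_mono onorm_cadjoint_le A B ab)
  finally show ?thesis
    using onorm_abs_combination_le[OF A B ab] by simp
qed

theorem theorem3p5:
  fixes T :: "'a::complex_hilbert_space \<Rightarrow> 'a" and l :: real
  assumes "bounded_clinear T" and "0 \<le> l" and "l \<le> 1"
  shows "(onorm (lambda_mean l T)
        \<le> (onorm (\<lambda>x. l *\<^sub>R abs_op T x + (1 - l) *\<^sub>R abs_op (duggal T) x)
          + onorm (\<lambda>x. l *\<^sub>R abs_op (cadjoint T) x + (1 - l) *\<^sub>R abs_op (cadjoint (duggal T)) x)) / 2
      \<and> (onorm (\<lambda>x. l *\<^sub>R abs_op T x + (1 - l) *\<^sub>R abs_op (duggal T) x)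
          + onorm (\<lambda>x. l *\<^sub>R abs_op (cadjoint T) x + (1 - l) *\<^sub>R abs_op (cadjoint (duggal T)) x)) / 2
        \<le> l * onorm T + (1 - l) * onorm (duggal T))
    \<and> (onorm (mean_transform T)
        \<le> (onorm (\<lambda>x. abs_op T x + abs_op (duggal T) x)
          + onorm (\<lambda>x. abs_op (cadjoint T) x + abs_op (cadjoint (duggal T)) x)) / 4
      \<and> (onorm (\<lambda>x. abs_op T x + abs_op (duggal T) x)
          + onorm (\<lambda>x. abs_op (cadjoint T) x + abs_op (cadjoint (duggal T)) x)) / 4
        \<le> onorm T)"
proof -
  note T = assms(1)
  note D = bounded_clinear_duggal[OF T]
  note T' = bounded_clinear_cadjoint[OF T] and D' = bounded_clinear_cadjoint[OF D]
  let ?P = "\<lambda>l x. l *\<^sub>R abs_op T x + (1 - l) *\<^sub>R abs_op (duggal T) x"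
  let ?Q = "\<lambda>l x. l *\<^sub>R abs_op (cadjoint T) x + (1 - l) *\<^sub>R abs_op (cadjoint (duggal T)) x"
  \<comment> \<open>Stated for every weight, as it is used at the given \<open>l\<close> and at
    1/2.\<close>
  have general: "onorm (lambda_mean l T) \<le> (onorm (?P l) + onorm (?Q l)) / 2"
    "(onorm (?P l) + onorm (?Q l)) / 2 \<le> l * onorm T + (1 - l) * onorm (duggal T)"
    if "0 \<le> l" "l \<le> 1" for l
  proof -
    show "onorm (lambda_mean l T) \<le> (onorm (?P l) + onorm (?Q l)) / 2"
      unfolding lambda_mean_def using that by (intro onorm_convex_combination_le T D) auto
    show "(onorm (?P l) + onorm (?Q l)) / 2 \<le> l * onorm T + (1 - l) * onorm (duggal T)"
      using that by (intro onorm_abs_combinations_mean_le T D) auto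
  qed
  \<comment> \<open>At weight 1/2 both coefficients are 1/2; taking them out of the norms turns the
    denominator 2 into 4.\<close>
  have half: "onorm (\<lambda>x. (1/2) *\<^sub>R F x + (1 - 1/2) *\<^sub>R G x) = onorm (\<lambda>x. F x + G x) / 2"
    if "bounded_clinear F" "bounded_clinear G" for F G :: "'a \<Rightarrow> 'a"
  proof -
    have "onorm (\<lambda>x. (1/2) *\<^sub>R (F x + G x)) = \<bar>1/2\<bar> * onorm (\<lambda>x. F x + G x)"
      by (intro onorm_scaleR bounded_clinear_bounded_linear bounded_clinear_add_fun that)
    then show ?thesis by (simp add: scaleR_add_right)
  qed
  have "onorm (?P (1/2)) = onorm (\<lambda>x. abs_op T x + abs_op (duggal T) x) / 2"
    "onorm (?Q (1/2)) = onorm (\<lambda>x. abs_op (cadjoint T) x + abs_op (cadjoint (duggal T)) x) / 2"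
    by (intro half bounded_clinear_abs_op T D T' D')+
  \<comment> \<open>In the mean case the upper bound is the average of the norms of \<open>T\<close>
    and \<open>duggal T\<close>, at most \<open>onorm T\<close> by
    \<open>onorm_duggal_le\<close>.\<close>
  then show ?thesis
    using general[OF assms(2,3)] general[of "1/2"] onorm_duggal_le[OF T]
    unfolding mean_transform_def by simp
qed

end
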